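(* $N(2,2,2)\le 4$. That is, for every set $P\subseteq\mathbb{R}^2$ and every finite family $\mathcal{B}$ of axis-parallel boxes (rectangles) in $\mathbb{R}^2$ such that the trace $\mathcal{B}|_P$ has the $(2,2)$-property and $\emptyset\notin\mathcal{B}|_P$, we have $\tau(\mathcal{B}|_P)\le 4$.
   Context: An axis-parallel box in $\mathbb{R}^d$ is a Cartesian product of $d$ closed intervals in $\mathbb{R}$; for $d=2$ it is called a rectangle. For a set $X$ and a family $\mathcal{F}$ of sets, the trace of $\mathcal{F}$ on $X$ is $\mathcal{F}|_X=\{F\cap X: F\in\mathcal{F}\}$. For integers $p\ge q$, a family $\mathcal{F}$ has the $(p,q)$-property if among every $p$ members of $\mathcal{F}$ there are $q$ members that intersect (i.e. have a common point). The piercing number $\tau(\mathcal{F})$ is the smallest size of a set $S$ that intersects every member of $\mathcal{F}$. $N(p,q,d)$ denotes the minimal universal upper bound on $\tau(\mathcal{B}|_P)$ over all sets $P\subseteq\mathbb{R}^d$ and all finite families $\mathcal{B}$ of axis-parallel boxes in $\mathbb{R}^d$ such that $\mathcal{B}|_P$ has the $(p,q)$-property and does not contain the empty set. *)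

theory Defs
  imports "HOL-Analysis.Analysis" "HOL-Library.Extended_Nat"
begin

text \<open>
  A closed interval may be degenerate or empty here; an empty box has an empty trace, and
  families with an empty trace are excluded in \<open>universal_piercing_number\<close>.
\<close>

definition axis_parallel_box :: "(real ^ 'd) set \<Rightarrow> bool" where
  "axis_parallel_box B \<longleftrightarrow> (\<exists>a b. B = cbox a b)"

definition trace :: "'a set set \<Rightarrow> 'a set \<Rightarrow> 'a set set" where
  "trace \<F> X = {F \<inter> X | F. F \<in> \<F>}"

text \<open>The \<open>p\<close> members, and the \<open>q\<close> members among them, are pairwise distinct.\<close>

definition pq_property :: "nat \<Rightarrow> nat \<Rightarrow> 'a set set \<Rightarrow> bool" where
  "pq_property p q \<F> \<longleftrightarrow>
    (\<forall>\<G>. \<G> \<subseteq> \<F> \<and> finite \<G> \<and> card \<G> = p \<longrightarrow>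
      (\<exists>\<H>. \<H> \<subseteq> \<G> \<and> card \<H> = q \<and> \<Inter>\<H> \<noteq> {}))"

text \<open>The piercing number is \<open>\<infinity>\<close> if no finite set intersects every member of the family.\<close>

definition piercing_number :: "'a set set \<Rightarrow> enat" where
  "piercing_number \<F> = Inf {enat (card S) | S. finite S \<and> (\<forall>F\<in>\<F>. S \<inter> F \<noteq> {})}"

text \<open>
  \<open>N(p,q,d)\<close>, with the dimension \<open>d\<close> given by a finite index type: \<open>d = CARD('d)\<close>.
  The least element exists because \<open>enat\<close> is well-ordered and \<open>\<infinity>\<close> is always an upper bound.
\<close>

definition universal_piercing_number :: "nat \<Rightarrow> nat \<Rightarrow> 'd::finite itself \<Rightarrow> enat" where
  "universal_piercing_number p q (_ :: 'd itself) =
    (LEAST n. \<forall>(P :: (real ^ 'd) set) \<B>.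
      finite \<B> \<and> (\<forall>B\<in>\<B>. axis_parallel_box B) \<and>
      pq_property p q (trace \<B> P) \<and> {} \<notin> trace \<B> P \<longrightarrow>
      piercing_number (trace \<B> P) \<le> n)"

lemma axis_parallel_box_iff_product:
  "axis_parallel_box (B :: (real ^ 'd) set) \<longleftrightarrow>
    (\<exists>a b. B = {x. \<forall>i. x $ i \<in> {a i..b i}})"
proof
  assume "axis_parallel_box B"
  then obtain a b where "B = cbox a b"
    by (auto simp: axis_parallel_box_def)
  then have "B = {x. \<forall>i. x $ i \<in> {($) a i..($) b i}}"
    by (auto simp: mem_box_cart)
  then show "\<exists>a b. B = {x. \<forall>i. x $ i \<in> {a i..b i}}"
    by blast
next
  assume "\<exists>a b. B = {x. \<forall>i. x $ i \<in> {a i..b i}}"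
  then obtain a b where "B = {x. \<forall>i. x $ i \<in> {a i..b i}}"
    by blast
  then have "B = cbox (\<chi> i. a i) (\<chi> i. b i)"
    by (auto simp: mem_box_cart)
  then show "axis_parallel_box B"
    by (auto simp: axis_parallel_box_def)
qed

lemma universal_piercing_number_le_iff:
  "universal_piercing_number p q TYPE('d::finite) \<le> n \<longleftrightarrow>
    (\<forall>(P :: (real ^ 'd) set) \<B>.
      finite \<B> \<and> (\<forall>B\<in>\<B>. axis_parallel_box B) \<and>
      pq_property p q (trace \<B> P) \<and> {} \<notin> trace \<B> P \<longrightarrow>
      piercing_number (trace \<B> P) \<le> n)"
  (is "_ \<longleftrightarrow> ?bound n")
proof
  have "?bound (LEAST n. ?bound n)"
    by (rule LeastI[of ?bound \<infinity>]) simp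
  moreover assume "universal_piercing_number p q TYPE('d) \<le> n"
  ultimately show "?bound n"
    unfolding universal_piercing_number_def by (meson order_trans)
next
  assume "?bound n"
  then show "universal_piercing_number p q TYPE('d) \<le> n"
    unfolding universal_piercing_number_def by (rule Least_le)
qed

end

theory Submission
  imports Defs
begin

text \<open>
  All boxes of the family contain a common point \<open>o\<close>, because their projections to either axis
  pairwise intersect. The horizontal line through \<open>o\<close> cuts the plane into an upper and a lower
  half. For a height \<open>U\<close> above \<open>o\<close>, consider the points of \<open>P\<close> in the strip between \<open>o\<close> and \<open>U\<close>
  and, among them, the two that are nearest to the vertical line through \<open>o\<close>, one on each side.
  A box that reaches up to \<open>U\<close> and has a point of \<open>P\<close> in this strip contains one of the two,
  since its horizontal side contains \<open>o\<close> (\<open>two_nearest_points\<close>). So the two points pierce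
  every box \<open>R\<close> for which \<open>U\<close> lies in the interval \<open>I R\<close> from the height of the lowest upper
  point of \<open>R \<inter> P\<close> to the top of \<open>R\<close>. Symmetrically, a height \<open>D\<close> below \<open>o\<close> provides two points
  that pierce every \<open>R\<close> for which \<open>D\<close> lies in the interval \<open>J R\<close> from the bottom of \<open>R\<close> to the
  height of the highest lower point of \<open>R \<inter> P\<close>.

  Two boxes share a point of \<open>P\<close>, above or below \<open>o\<close>; the height of this point lies in both of
  their intervals \<open>I\<close> or in both of their intervals \<open>J\<close>. The planar problem thus becomes
  one-dimensional: given pairs of intervals \<open>(I R, J R)\<close> on two separate lines such that any two
  pairs meet on one of the lines, one point \<open>U\<close> on the first line and one point \<open>D\<close> on the second
  suffice to pierce every pair. This is the case of matching number one of Tardos's theorem on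
  2-intervals, and it has a short proof (\<open>two_track_intervals_pierced\<close>). It yields two points
  above and two points below, four in total.
\<close>

section \<open>Piercing intervals\<close>

text \<open>Helly's theorem on the line: the largest left endpoint is a common point.\<close>

lemma intervals_common_point:
  fixes a b :: "'i \<Rightarrow> real"
  assumes "finite F" and "\<And>R S. R \<in> F \<Longrightarrow> S \<in> F \<Longrightarrow> a R \<le> b S"
  shows "\<exists>t. \<forall>R\<in>F. a R \<le> t \<and> t \<le> b R"
proof (cases "F = {}")
  case False
  with assms have "\<forall>R\<in>F. a R \<le> Max (a ` F) \<and> Max (a ` F) \<le> b R"
    by auto
  then show ?thesis
    by blast
qed simp

text \<open>
  Unless all pairs meet on the second line, the point \<open>U\<close> is placed as far right as possible such
  that the pairs lying to the left of \<open>U\<close> on the first line still pairwise meet on the second.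
  Then \<open>U\<close> is the larger right endpoint, on the first line, of some two pairs \<open>R\<close>, \<open>S\<close> that are
  disjoint on the second. A pair lying to the right of \<open>U\<close> misses \<open>R\<close> and \<open>S\<close> on
  the first line, so on the second line it meets both and covers the gap between them. Hence all pairs missed by \<open>U\<close> meet pairwise on the second line.
  Intervals with \<open>a R > b R\<close> or \<open>c R > d R\<close> are empty; the hypothesis for \<open>R = S\<close> makes one of the
  two intervals of each pair nonempty.
\<close>

lemma two_track_intervals_pierced:
  fixes a b c d :: "'i \<Rightarrow> real"
  assumes fin: "finite F"
    and meet: "\<And>R S. R \<in> F \<Longrightarrow> S \<in> F \<Longrightarrow>
      {a R..b R} \<inter> {a S..b S} \<noteq> {} \<or> {c R..d R} \<inter> {c S..d S} \<noteq> {}"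
  shows "\<exists>U D. \<forall>R\<in>F. U \<in> {a R..b R} \<or> D \<in> {c R..d R}"
proof -
  have helly: "\<exists>D. \<forall>R\<in>G. D \<in> {c R..d R}"
    if "G \<subseteq> F" and "\<And>R S. R \<in> G \<Longrightarrow> S \<in> G \<Longrightarrow> {c R..d R} \<inter> {c S..d S} \<noteq> {}" for G
    using intervals_common_point[of G c d] that finite_subset[OF that(1) fin] by fastforce
  define bad where "bad = {(R, S) \<in> F \<times> F. {c R..d R} \<inter> {c S..d S} = {}}"
  define larger_end where "larger_end = (\<lambda>(R, S). max (b R) (b S))"
  show ?thesis
  proof (cases "bad = {}")
    case True
    then show ?thesis
      using helly[of F] unfolding bad_def by blast
  next
    case False
    have "finite bad"
      by (rule finite_subset[of _ "F \<times> F"]) (auto simp: bad_def fin)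
    then obtain RS where "is_arg_min larger_end (\<lambda>p. p \<in> bad) RS"
      using ex_is_arg_min_if_finite[OF _ False, of larger_end] by blast
    then obtain R S where RS: "(R, S) \<in> bad"
      and least: "\<And>R' S'. (R', S') \<in> bad \<Longrightarrow> max (b R) (b S) \<le> max (b R') (b S')"
      unfolding is_arg_min_linorder larger_end_def by (cases RS) auto
    define U where "U = max (b R) (b S)"
    have RS_F: "R \<in> F" "S \<in> F" and disjoint: "{c R..d R} \<inter> {c S..d S} = {}"
      using RS by (auto simp: bad_def)
    define missed where "missed = {Q \<in> F. U \<notin> {a Q..b Q}}"
    have "{c Q..d Q} \<inter> {c Q'..d Q'} \<noteq> {}" if QQ': "Q \<in> missed" "Q' \<in> missed" for Q Q'
    proof
      assume empty: "{c Q..d Q} \<inter> {c Q'..d Q'} = {}"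
      have Q_F: "Q \<in> F" "Q' \<in> F" and U: "U \<notin> {a Q..b Q}" "U \<notin> {a Q'..b Q'}"
        using QQ' by (auto simp: missed_def)
      then have "(Q, Q') \<in> bad"
        using empty by (auto simp: bad_def)
      then have "U \<le> max (b Q) (b Q')"
        unfolding U_def by (rule least)
      moreover obtain t where "t \<in> {a Q..b Q}" "t \<in> {a Q'..b Q'}"
        using meet[OF Q_F] empty by blast
      ultimately have right: "U < a Q" "U < a Q'"
        using U by auto
      then have "{a Q..b Q} \<inter> {a T..b T} = {}" "{a Q'..b Q'} \<inter> {a T..b T} = {}"
        if "T \<in> {R, S}" for T
        using that by (auto simp: U_def)
      then have covers: "{c Q..d Q} \<inter> {c T..d T} \<noteq> {}" "{c Q'..d Q'} \<inter> {c T..d T} \<noteq> {}"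
        if "T \<in> {R, S}" for T
        using that meet[of Q T] meet[of Q' T] Q_F RS_F by auto
      \<comment> \<open>The larger of the two left endpoints is the right end of the gap between \<open>R\<close> and \<open>S\<close>.\<close>
      have "max (c R) (c S) \<in> {c Q..d Q} \<inter> {c Q'..d Q'}"
        using covers[of R] covers[of S] disjoint by auto
      then show False
        using empty by blast
    qed
    then obtain D where "\<forall>Q\<in>missed. D \<in> {c Q..d Q}"
      using helly[of missed] unfolding missed_def by blast
    then have "\<forall>Q\<in>F. U \<in> {a Q..b Q} \<or> D \<in> {c Q..d Q}"
      unfolding missed_def by blast
    then show ?thesis
      by blast
  qed
qed

section \<open>Piercing boxes by points of a finite set\<close>

text \<open>The nearest point on either side of \<open>c\<close>; on a side without points there is none.\<close>

lemma two_nearest_points: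
  fixes f :: "'a \<Rightarrow> real"
  assumes "finite X"
  shows "\<exists>S \<subseteq> X. card S \<le> 2 \<and>
    (\<forall>l r. l \<le> c \<and> c \<le> r \<and> (\<exists>z\<in>X. l \<le> f z \<and> f z \<le> r) \<longrightarrow> (\<exists>s\<in>S. l \<le> f s \<and> f s \<le> r))"
proof -
  have minimizer: "\<exists>A \<subseteq> Y. card A \<le> 1 \<and> (\<forall>z\<in>Y. \<exists>s\<in>A. g s \<le> g z)"
    if fin: "finite Y" for Y and g :: "'a \<Rightarrow> real"
  proof (cases "Y = {}")
    case False
    then obtain s where "is_arg_min g (\<lambda>z. z \<in> Y) s"
      using ex_is_arg_min_if_finite[OF fin] by blast
    then show ?thesis
      by (intro exI[of _ "{s}"]) (auto simp: is_arg_min_linorder)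
  qed simp
  obtain A where A: "A \<subseteq> {z \<in> X. c \<le> f z}" "card A \<le> 1"
    and A_near: "\<forall>z\<in>{z \<in> X. c \<le> f z}. \<exists>s\<in>A. f s \<le> f z"
    using minimizer[of "{z \<in> X. c \<le> f z}" f] assms by auto
  obtain B where B: "B \<subseteq> {z \<in> X. f z \<le> c}" "card B \<le> 1"
    and B_near: "\<forall>z\<in>{z \<in> X. f z \<le> c}. \<exists>s\<in>B. - f s \<le> - f z"
    using minimizer[of "{z \<in> X. f z \<le> c}" "\<lambda>z. - f z"] assms by auto
  have "\<exists>s\<in>A \<union> B. l \<le> f s \<and> f s \<le> r"
    if "l \<le> c" "c \<le> r" "z \<in> X" "l \<le> f z" "f z \<le> r" for l r z
  proof (cases "c \<le> f z")
    case True
    then obtain s where "s \<in> A" "f s \<le> f z"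
      using A_near \<open>z \<in> X\<close> by blast
    moreover have "c \<le> f s"
      using \<open>s \<in> A\<close> A by blast
    ultimately show ?thesis
      using that by (intro bexI[of _ s]) auto
  next
    case False
    then obtain s where "s \<in> B" "- f s \<le> - f z"
      using B_near \<open>z \<in> X\<close> by force
    moreover have "f s \<le> c"
      using \<open>s \<in> B\<close> B by blast
    ultimately show ?thesis
      using that by (intro bexI[of _ s]) auto
  qed
  moreover have "card (A \<union> B) \<le> 2"
    using card_Un_le[of A B] A B by linarith
  ultimately show ?thesis
    using A B by (intro exI[of _ "A \<union> B"]) blast
qed

lemma mem_cbox_2:
  fixes z :: "real ^ 2"
  shows "z \<in> cbox p q \<longleftrightarrow> p $ 1 \<le> z $ 1 \<and> z $ 1 \<le> q $ 1 \<and> p $ 2 \<le> z $ 2 \<and> z $ 2 \<le> q $ 2"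
  by (auto simp: mem_box_cart forall_2)

lemma boxes_pierced_by_four_of_finite:
  fixes P :: "(real ^ 2) set" and lo hi :: "'i \<Rightarrow> real ^ 2"
  assumes finF: "finite F" and finP: "finite P"
    and meet: "\<And>R S. R \<in> F \<Longrightarrow> S \<in> F \<Longrightarrow> \<exists>z\<in>P. z \<in> cbox (lo R) (hi R) \<and> z \<in> cbox (lo S) (hi S)"
  shows "\<exists>T \<subseteq> P. card T \<le> 4 \<and> (\<forall>R\<in>F. T \<inter> cbox (lo R) (hi R) \<noteq> {})"
proof -
  have le: "lo R $ i \<le> hi S $ i" if "R \<in> F" "S \<in> F" for R S i
    using meet[OF that] by (meson mem_box_cart order_trans)
  obtain x where x: "\<forall>R\<in>F. lo R $ 1 \<le> x \<and> x \<le> hi R $ 1"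
    using intervals_common_point[of F "\<lambda>R. lo R $ 1" "\<lambda>R. hi R $ 1"] finF le by blast
  obtain y where y: "\<forall>R\<in>F. lo R $ 2 \<le> y \<and> y \<le> hi R $ 2"
    using intervals_common_point[of F "\<lambda>R. lo R $ 2" "\<lambda>R. hi R $ 2"] finF le by blast
  define upper where "upper R = {z \<in> P. z \<in> cbox (lo R) (hi R) \<and> y \<le> z $ 2}" for R
  define lower where "lower R = {z \<in> P. z \<in> cbox (lo R) (hi R) \<and> z $ 2 \<le> y}" for R
  have fin: "finite (upper R)" "finite (lower R)" for R
    using finP by (auto simp: upper_def lower_def)
  \<comment> \<open>A box without upper (or lower) points gets an empty interval, by an endpoint shifted by 1.\<close>
  define a where "a R = (if upper R = {} then hi R $ 2 + 1 else Min ((\<lambda>z. z $ 2) ` upper R))" for R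
  define d where "d R = (if lower R = {} then lo R $ 2 - 1 else Max ((\<lambda>z. z $ 2) ` lower R))" for R
  have a_le: "a R \<le> z $ 2" if "z \<in> upper R" for R z
    using that fin by (auto simp: a_def)
  have d_ge: "z $ 2 \<le> d R" if "z \<in> lower R" for R z
    using that fin by (auto simp: d_def)
  have a_point: "\<exists>z\<in>upper R. z $ 2 = a R" if "a R \<le> hi R $ 2" for R
  proof -
    have nonempty: "upper R \<noteq> {}"
      using that by (auto simp: a_def)
    then have "a R \<in> (\<lambda>z. z $ 2) ` upper R"
      using Min_in[of "(\<lambda>z. z $ 2) ` upper R"] fin by (simp add: a_def)
    then show ?thesis
      by force
  qed
  have d_point: "\<exists>z\<in>lower R. z $ 2 = d R" if "lo R $ 2 \<le> d R" for R
  proof -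
    have nonempty: "lower R \<noteq> {}"
      using that by (auto simp: d_def)
    then have "d R \<in> (\<lambda>z. z $ 2) ` lower R"
      using Max_in[of "(\<lambda>z. z $ 2) ` lower R"] fin by (simp add: d_def)
    then show ?thesis
      by force
  qed
  have tracks: "{a R..hi R $ 2} \<inter> {a S..hi S $ 2} \<noteq> {} \<or> {lo R $ 2..d R} \<inter> {lo S $ 2..d S} \<noteq> {}"
    if RS: "R \<in> F" "S \<in> F" for R S
  proof -
    obtain z where z: "z \<in> P" "z \<in> cbox (lo R) (hi R)" "z \<in> cbox (lo S) (hi S)"
      using meet[OF RS] by blast
    show ?thesis
    proof (cases "y \<le> z $ 2")
      case True
      with z have "z \<in> upper R" "z \<in> upper S"
        by (auto simp: upper_def)
      then have "z $ 2 \<in> {a R..hi R $ 2} \<inter> {a S..hi S $ 2}"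
        using z a_le by (auto simp: mem_cbox_2)
      then show ?thesis
        by blast
    next
      case False
      with z have "z \<in> lower R" "z \<in> lower S"
        by (auto simp: lower_def)
      then have "z $ 2 \<in> {lo R $ 2..d R} \<inter> {lo S $ 2..d S}"
        using z d_ge by (auto simp: mem_cbox_2)
      then show ?thesis
        by blast
    qed
  qed
  obtain U D where UD: "\<forall>R\<in>F. U \<in> {a R..hi R $ 2} \<or> D \<in> {lo R $ 2..d R}"
    using two_track_intervals_pierced[of F a "\<lambda>R. hi R $ 2" "\<lambda>R. lo R $ 2" d] finF tracks
    by blast
  have fin_A: "finite {z \<in> P. y \<le> z $ 2 \<and> z $ 2 \<le> U}"
    using finP by simp
  obtain A where A: "A \<subseteq> {z \<in> P. y \<le> z $ 2 \<and> z $ 2 \<le> U}" "card A \<le> 2"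
    and A_near: "\<forall>l r. l \<le> x \<and> x \<le> r \<and>
      (\<exists>z\<in>{z \<in> P. y \<le> z $ 2 \<and> z $ 2 \<le> U}. l \<le> z $ 1 \<and> z $ 1 \<le> r) \<longrightarrow>
      (\<exists>s\<in>A. l \<le> s $ 1 \<and> s $ 1 \<le> r)"
    using two_nearest_points[OF fin_A, of x "\<lambda>z. z $ 1"] by (elim exE conjE)
  have fin_B: "finite {z \<in> P. D \<le> z $ 2 \<and> z $ 2 \<le> y}"
    using finP by simp
  obtain B where B: "B \<subseteq> {z \<in> P. D \<le> z $ 2 \<and> z $ 2 \<le> y}" "card B \<le> 2"
    and B_near: "\<forall>l r. l \<le> x \<and> x \<le> r \<and>
      (\<exists>z\<in>{z \<in> P. D \<le> z $ 2 \<and> z $ 2 \<le> y}. l \<le> z $ 1 \<and> z $ 1 \<le> r) \<longrightarrow>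
      (\<exists>s\<in>B. l \<le> s $ 1 \<and> s $ 1 \<le> r)"
    using two_nearest_points[OF fin_B, of x "\<lambda>z. z $ 1"] by (elim exE conjE)
  have "(A \<union> B) \<inter> cbox (lo R) (hi R) \<noteq> {}" if R: "R \<in> F" for R
  proof (cases "U \<in> {a R..hi R $ 2}")
    case True
    then obtain z where z: "z \<in> upper R" "z $ 2 = a R"
      using a_point[of R] by auto
    then have "z \<in> {z \<in> P. y \<le> z $ 2 \<and> z $ 2 \<le> U}" "lo R $ 1 \<le> z $ 1" "z $ 1 \<le> hi R $ 1"
      using True by (auto simp: upper_def mem_cbox_2)
    then obtain s where s: "s \<in> A" "lo R $ 1 \<le> s $ 1" "s $ 1 \<le> hi R $ 1"
      using A_near[rule_format, of "lo R $ 1" "hi R $ 1"] x R by blast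
    then have "s \<in> cbox (lo R) (hi R)"
      using A(1) True y R by (force simp: mem_cbox_2)
    then show ?thesis
      using s by blast
  next
    case False
    then have D: "D \<in> {lo R $ 2..d R}"
      using UD R by blast
    then obtain z where z: "z \<in> lower R" "z $ 2 = d R"
      using d_point[of R] by auto
    then have "z \<in> {z \<in> P. D \<le> z $ 2 \<and> z $ 2 \<le> y}" "lo R $ 1 \<le> z $ 1" "z $ 1 \<le> hi R $ 1"
      using D by (auto simp: lower_def mem_cbox_2)
    then obtain s where s: "s \<in> B" "lo R $ 1 \<le> s $ 1" "s $ 1 \<le> hi R $ 1"
      using B_near[rule_format, of "lo R $ 1" "hi R $ 1"] x R by blast
    then have "s \<in> cbox (lo R) (hi R)"
      using B(1) D y R by (force simp: mem_cbox_2)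
    then show ?thesis
      using s by blast
  qed
  moreover have "card (A \<union> B) \<le> 4"
    using card_Un_le[of A B] A B by linarith
  ultimately show ?thesis
    using A B by (intro exI[of _ "A \<union> B"]) blast
qed

section \<open>The bound for traces\<close>

text \<open>
  For infinite \<open>P\<close> there need not be nearest points, but the hypothesis involves only one common
  point for each of the finitely many pairs of boxes.
\<close>

lemma boxes_pierced_by_four:
  fixes P :: "(real ^ 2) set"
  assumes fin: "finite \<B>" and box: "\<forall>B\<in>\<B>. axis_parallel_box B"
    and meet: "\<And>R S. R \<in> \<B> \<Longrightarrow> S \<in> \<B> \<Longrightarrow> R \<inter> S \<inter> P \<noteq> {}"
  shows "\<exists>T \<subseteq> P. finite T \<and> card T \<le> 4 \<and> (\<forall>R\<in>\<B>. T \<inter> R \<noteq> {})"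
proof -
  obtain lo hi where R_eq: "\<forall>R\<in>\<B>. R = cbox (lo R) (hi R)"
    using box unfolding axis_parallel_box_def by metis
  have "\<forall>R\<in>\<B>. \<forall>S\<in>\<B>. \<exists>z. z \<in> R \<inter> S \<inter> P"
    using meet by blast
  then obtain w where w: "\<And>R S. R \<in> \<B> \<Longrightarrow> S \<in> \<B> \<Longrightarrow> w R S \<in> R \<inter> S \<inter> P"
    by metis
  define P' where "P' = (\<lambda>(R, S). w R S) ` (\<B> \<times> \<B>)"
  have P': "finite P'" "P' \<subseteq> P"
    using fin w by (auto simp: P'_def)
  have "\<exists>z\<in>P'. z \<in> cbox (lo R) (hi R) \<and> z \<in> cbox (lo S) (hi S)" if "R \<in> \<B>" "S \<in> \<B>" for R S
  proof (rule bexI)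
    show "w R S \<in> cbox (lo R) (hi R) \<and> w R S \<in> cbox (lo S) (hi S)"
      using w[OF that] R_eq that by blast
    show "w R S \<in> P'"
      using that by (auto simp: P'_def)
  qed
  then obtain T where "T \<subseteq> P'" "card T \<le> 4" "\<forall>R\<in>\<B>. T \<inter> cbox (lo R) (hi R) \<noteq> {}"
    using boxes_pierced_by_four_of_finite[OF fin P'(1), of lo hi] by blast
  then show ?thesis
    using P' R_eq finite_subset[of T P'] by (intro exI[of _ T]) auto
qed

lemma pq_property_2_2_meet:
  assumes "pq_property 2 2 \<F>" and "A \<in> \<F>" "B \<in> \<F>" "A \<noteq> B"
  shows "A \<inter> B \<noteq> {}"
proof -
  have AB: "{A, B} \<subseteq> \<F> \<and> finite {A, B} \<and> card {A, B} = 2"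
    using assms by simp
  then obtain \<H> where H: "\<H> \<subseteq> {A, B}" "card \<H> = 2" "\<Inter>\<H> \<noteq> {}"
    using assms(1)[unfolded pq_property_def, rule_format, OF AB] by blast
  then have "\<H> = {A, B}"
    using AB by (intro card_subset_eq) auto
  then show ?thesis
    using H by simp
qed

theorem theorem1p4:
  "universal_piercing_number 2 2 TYPE(2) \<le> 4"
  unfolding universal_piercing_number_le_iff
proof (intro allI impI, elim conjE)
  fix P :: "(real ^ 2) set" and \<B>
  assume fin: "finite \<B>" and box: "\<forall>B\<in>\<B>. axis_parallel_box B"
    and pq: "pq_property 2 2 (trace \<B> P)" and nonempty: "{} \<notin> trace \<B> P"
  \<comment> \<open>Distinct boxes may have equal traces; these share a point because they are not empty.\<close>
  have "R \<inter> S \<inter> P \<noteq> {}" if "R \<in> \<B>" "S \<in> \<B>" for R S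
  proof -
    have tr: "R \<inter> P \<in> trace \<B> P" "S \<inter> P \<in> trace \<B> P"
      using that by (auto simp: trace_def)
    then have "(R \<inter> P) \<inter> (S \<inter> P) \<noteq> {}"
      using pq_property_2_2_meet[OF pq tr] nonempty by (cases "R \<inter> P = S \<inter> P") auto
    then show ?thesis
      by blast
  qed
  then have "\<exists>T \<subseteq> P. finite T \<and> card T \<le> 4 \<and> (\<forall>R\<in>\<B>. T \<inter> R \<noteq> {})"
    by (rule boxes_pierced_by_four[OF fin box])
  then obtain T where T: "T \<subseteq> P" "finite T" "card T \<le> 4" "\<forall>R\<in>\<B>. T \<inter> R \<noteq> {}"
    by (elim exE conjE)
  then have "\<forall>F\<in>trace \<B> P. T \<inter> F \<noteq> {}"
    unfolding trace_def by blast
  then have "piercing_number (trace \<B> P) \<le> enat (card T)"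
    unfolding piercing_number_def using T(2) by (intro Inf_lower) blast
  also have "\<dots> \<le> enat 4"
    using T(3) by simp
  also have "enat 4 = 4"
    by (simp add: numeral_eq_enat)
  finally show "piercing_number (trace \<B> P) \<le> 4" .
qed

end
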